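(* There is a computable tree $T\subseteq\mathbb N^{<\omega}$ that is finitely branching and has exactly one branch $f:\mathbb N\to\mathbb N$, and this branch satisfies $\emptyset'\le_{\mathsf T}f$.
   Context: $\mathbb N^{<\omega}$ is the set of finite sequences of natural numbers; $\sigma\sqsubset\tau$ means that $\sigma$ is a proper initial segment of $\tau$, and $\sigma\star i$ is the extension of $\sigma$ by one further entry $i$. A tree is a set $T\subseteq\mathbb N^{<\omega}$ such that $\sigma\sqsubset\tau\in T$ entails $\sigma\in T$. A branch of $T$ is a function $f:\mathbb N\to\mathbb N$ with $\langle f(0),\ldots,f(n-1)\rangle\in T$ for all $n\in\mathbb N$. A tree $T$ is finitely branching if each $\sigma\in T$ admits an $N\in\mathbb N$ with $\sigma\star i\notin T$ for all $i\ge N$. Via a fixed primitive recursive coding of finite sequences by natural numbers, trees are viewed as subsets of $\mathbb N$, so that computability applies to them. $Y\le_{\mathsf T}Z$ means that the characteristic function of $Y$ is computable with oracle $Z$; a function $f:\mathbb N\to\mathbb N$ is identified with its coded graph $\{\pi(m,n)\mid f(m)=n\}$, where $\pi:\mathbb N^2\to\mathbb N$ is the Cantor pairing function. The set $\emptyset'$ is the halting set $\{\pi(e,n)\mid\{e\}(n)\text{ is defined}\}$, where $\{e\}$ is the partial computable function computed by the program with code $e$. *)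

theory Defs
  imports Main "HOL-Library.Nat_Bijection" "HOL-Library.Sublist"
begin

(* Kleene's schemes for partial recursive functions relative to an oracle, in one-argument form:
   a function of several arguments is a function of their iterated Cantor pairing.
   The pairing prod_encode is the Cantor pairing: prod_encode (m, n) = (m + n) (m + n + 1) / 2 + m. *)
datatype prog =
    Zero
  | Succ
  | First
  | Second
  | Oracle
  | Tuple prog prog
  | Comp prog prog
  | PrimRec prog prog
  | Minim prog

(* run Z p n is the value of program p with oracle Z on input n; None means undefined.
   With base p and step q, primitive recursion gives h (a, 0) = p a and
   h (a, k + 1) = q (a, (k, h (a, k))).  Minimisation sends n to the least k with p (n, k) = 0,
   provided that p (n, j) is defined for all j < k. *)
primrec run :: "nat set \<Rightarrow> prog \<Rightarrow> nat \<Rightarrow> nat option" where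
  "run Z Zero = (\<lambda>n. Some 0)"
| "run Z Succ = (\<lambda>n. Some (Suc n))"
| "run Z First = (\<lambda>n. Some (fst (prod_decode n)))"
| "run Z Second = (\<lambda>n. Some (snd (prod_decode n)))"
| "run Z Oracle = (\<lambda>n. Some (if n \<in> Z then 1 else 0))"
| "run Z (Tuple p q) = (\<lambda>n. Option.bind (run Z p n) (\<lambda>x.
     Option.bind (run Z q n) (\<lambda>y. Some (prod_encode (x, y)))))"
| "run Z (Comp p q) = (\<lambda>n. Option.bind (run Z q n) (run Z p))"
| "run Z (PrimRec p q) = (\<lambda>n. case prod_decode n of (a, m) \<Rightarrow>
     rec_nat (run Z p a)
       (\<lambda>k r. Option.bind r (\<lambda>v. run Z q (prod_encode (a, prod_encode (k, v))))) m)"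
| "run Z (Minim p) = (\<lambda>n.
     let good = (\<lambda>k. run Z p (prod_encode (n, k)) = Some 0 \<and>
                  (\<forall>j<k. run Z p (prod_encode (n, j)) \<noteq> None))
     in if \<exists>k. good k then Some (LEAST k. good k) else None)"

primrec prog_code :: "prog \<Rightarrow> nat" where
  "prog_code Zero = prod_encode (0, 0)"
| "prog_code Succ = prod_encode (1, 0)"
| "prog_code First = prod_encode (2, 0)"
| "prog_code Second = prod_encode (3, 0)"
| "prog_code Oracle = prod_encode (4, 0)"
| "prog_code (Tuple p q) = prod_encode (5, prod_encode (prog_code p, prog_code q))"
| "prog_code (Comp p q) = prod_encode (6, prod_encode (prog_code p, prog_code q))"
| "prog_code (PrimRec p q) = prod_encode (7, prod_encode (prog_code p, prog_code q))"
| "prog_code (Minim p) = prod_encode (8, prog_code p)"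

lemma prog_code_inject: "prog_code p = prog_code q \<Longrightarrow> p = q"
  by (induction p arbitrary: q) (case_tac q; simp)+

definition turing_le :: "nat set \<Rightarrow> nat set \<Rightarrow> bool" (infix "\<le>\<^sub>T" 50) where
  "Y \<le>\<^sub>T Z \<longleftrightarrow> (\<exists>p. \<forall>n. run Z p n = Some (if n \<in> Y then 1 else 0))"

(* Queries to the empty oracle are answered by the constant 0, so this is computability
   without an oracle. *)
definition computable :: "nat set \<Rightarrow> bool" where
  "computable Y \<longleftrightarrow> Y \<le>\<^sub>T {}"

(* {e}(n) counts as undefined if e is not the code of a program. *)
definition halting_set :: "nat set" where
  "halting_set = {prod_encode (e, n) | e n. \<exists>p. prog_code p = e \<and> run {} p n \<noteq> None}"

definition fun_graph :: "(nat \<Rightarrow> nat) \<Rightarrow> nat set" where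
  "fun_graph f = {prod_encode (m, n) | m n. f m = n}"

definition is_tree :: "nat list set \<Rightarrow> bool" where
  "is_tree T \<longleftrightarrow> (\<forall>\<sigma> \<tau>. strict_prefix \<sigma> \<tau> \<longrightarrow> \<tau> \<in> T \<longrightarrow> \<sigma> \<in> T)"

definition is_branch :: "nat list set \<Rightarrow> (nat \<Rightarrow> nat) \<Rightarrow> bool" where
  "is_branch T f \<longleftrightarrow> (\<forall>n. map f [0..<n] \<in> T)"

definition finitely_branching :: "nat list set \<Rightarrow> bool" where
  "finitely_branching T \<longleftrightarrow> (\<forall>\<sigma>\<in>T. \<exists>N. \<forall>i\<ge>N. \<sigma> @ [i] \<notin> T)"

definition computable_tree :: "nat list set \<Rightarrow> bool" where
  "computable_tree T \<longleftrightarrow> is_tree T \<and> computable (list_encode ` T)"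

end

theory Submission
  imports Defs
begin

text \<open>
  Let \<open>W i t\<close> be a decidable relation with \<open>i \<in> halting_set\<close> iff \<open>\<exists>t. W i t\<close>. The tree consists of the
  sequences that guess, for each \<open>i\<close>, either \<open>0\<close> (no witness) or \<open>Suc t\<close> for the least witness \<open>t\<close>
  of \<open>i\<close>. A guess \<open>0\<close> survives as long as no witness below the length of the sequence refutes it,
  so each node has at most two children, and only the correct guesses extend to a branch.
  The witnesses are codes of lists of judgements ``\<open>e\<close> codes a program'' and ``program \<open>e\<close> maps \<open>n\<close>
  to \<open>v\<close>'', each of which follows by one evaluation step from later entries of the list.
\<close>

section \<open>Closure properties of computability\<close>

definition pfst :: "nat \<Rightarrow> nat" where "pfst n = fst (prod_decode n)"
definition psnd :: "nat \<Rightarrow> nat" where "psnd n = snd (prod_decode n)"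

lemma pfst_pair [simp]: "pfst (prod_encode (a, b)) = a"
  and psnd_pair [simp]: "psnd (prod_encode (a, b)) = b"
  and pair_pfst_psnd [simp]: "prod_encode (pfst n, psnd n) = n"
  by (simp_all add: pfst_def psnd_def)

text \<open>Lets the tail operation on list codes, \<open>psnd (v - 1)\<close>, fix the code 0 of
  the empty list.\<close>

lemma psnd_0 [simp]: "psnd 0 = 0"
  by (simp add: psnd_def prod_decode_def prod_decode_aux.simps)

definition recursive_in :: "nat set \<Rightarrow> (nat \<Rightarrow> nat) \<Rightarrow> bool" where
  "recursive_in Z f \<longleftrightarrow> (\<exists>p. \<forall>n. run Z p n = Some (f n))"

definition decidable_in :: "nat set \<Rightarrow> (nat \<Rightarrow> bool) \<Rightarrow> bool" where
  "decidable_in Z P \<longleftrightarrow> recursive_in Z (\<lambda>n. if P n then 1 else 0)"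

lemma turing_le_iff_decidable_in: "Y \<le>\<^sub>T Z \<longleftrightarrow> decidable_in Z (\<lambda>n. n \<in> Y)"
  by (simp add: turing_le_def decidable_in_def recursive_in_def)

lemma recursive_inI: "(\<And>n. run Z p n = Some (f n)) \<Longrightarrow> recursive_in Z f"
  unfolding recursive_in_def by blast

lemma recursive_inE:
  assumes "recursive_in Z f" obtains p where "\<And>n. run Z p n = Some (f n)"
  using assms unfolding recursive_in_def by metis

text \<open>Closure rules that prove computability of an expression by following its syntax. Most
  take functions of \<open>x\<close> as arguments, so that composition is built in.\<close>

named_theorems recI

lemma recursive_in_compose:
  assumes "recursive_in Z f" "recursive_in Z g"
  shows "recursive_in Z (\<lambda>x. f (g x))"
proof -
  obtain p where p: "\<And>n. run Z p n = Some (f n)" using assms(1) by (rule recursive_inE) blast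
  obtain q where q: "\<And>n. run Z q n = Some (g n)" using assms(2) by (rule recursive_inE) blast
  show ?thesis by (rule recursive_inI[where p = "Comp p q"]) (simp add: p q)
qed

lemma recursive_in_pair [recI]:
  assumes "recursive_in Z f" "recursive_in Z g"
  shows "recursive_in Z (\<lambda>x. prod_encode (f x, g x))"
proof -
  obtain p where p: "\<And>n. run Z p n = Some (f n)" using assms(1) by (rule recursive_inE) blast
  obtain q where q: "\<And>n. run Z q n = Some (g n)" using assms(2) by (rule recursive_inE) blast
  show ?thesis by (rule recursive_inI[where p = "Tuple p q"]) (simp add: p q)
qed

lemma recursive_in_pfst [recI]: "recursive_in Z f \<Longrightarrow> recursive_in Z (\<lambda>x. pfst (f x))"
  by (rule recursive_in_compose[where f = pfst])
    (auto simp: pfst_def intro: recursive_inI[where p = First])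

lemma recursive_in_psnd [recI]: "recursive_in Z f \<Longrightarrow> recursive_in Z (\<lambda>x. psnd (f x))"
  by (rule recursive_in_compose[where f = psnd])
    (auto simp: psnd_def intro: recursive_inI[where p = Second])

lemma recursive_in_Suc [recI]: "recursive_in Z f \<Longrightarrow> recursive_in Z (\<lambda>x. Suc (f x))"
  by (rule recursive_in_compose[where f = Suc]) (auto intro: recursive_inI[where p = Succ])

lemma recursive_in_ident [recI]: "recursive_in Z (\<lambda>x. x)"
  by (rule recursive_inI[where p = "Tuple First Second"]) simp

lemma recursive_in_const [recI]: "recursive_in Z (\<lambda>x. c)"
proof (induction c)
  case 0
  show ?case by (rule recursive_inI[where p = Zero]) simp
qed (rule recursive_in_Suc)

text \<open>The input \<open>x\<close> is kept as the parameter of the recursion. In the third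
  hypothesis \<open>z\<close> codes \<open>(x, (k, v))\<close>, in the order in which
  \<open>PrimRec\<close> feeds its step; pairing \<open>x\<close> with \<open>m x\<close> then
  supplies the number of rounds.\<close>

lemma recursive_in_rec_nat:
  assumes "recursive_in Z b" "recursive_in Z m"
    and "recursive_in Z (\<lambda>z. s (pfst z) (pfst (psnd z)) (psnd (psnd z)))"
  shows "recursive_in Z (\<lambda>x. rec_nat (b x) (s x) (m x))"
proof -
  obtain p where p: "\<And>n. run Z p n = Some (b n)"
    using assms(1) by (rule recursive_inE) blast
  obtain q where q: "\<And>n. run Z q n = Some (s (pfst n) (pfst (psnd n)) (psnd (psnd n)))"
    using assms(3) by (rule recursive_inE) blast
  have "run Z (PrimRec p q) (prod_encode (a, k)) = Some (rec_nat (b a) (s a) k)" for a k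
    by (induction k) (simp_all add: p q)
  then have "run Z (PrimRec p q) n = Some (rec_nat (b (pfst n)) (s (pfst n)) (psnd n))" for n
    by (metis pair_pfst_psnd)
  then have "recursive_in Z (\<lambda>n. rec_nat (b (pfst n)) (s (pfst n)) (psnd n))"
    by (rule recursive_inI)
  from recursive_in_compose[OF this recursive_in_pair[OF recursive_in_ident assms(2)]]
  show ?thesis by simp
qed

text \<open>A case distinction is a recursion of zero or one rounds: the base yields
  \<open>g x\<close>, and a single step discards it in favour of \<open>f x\<close>.\<close>

lemma recursive_in_if [recI]:
  assumes "decidable_in Z P" "recursive_in Z f" "recursive_in Z g"
  shows "recursive_in Z (\<lambda>x. if P x then f x else g x)"
proof -
  have "recursive_in Z (\<lambda>x. rec_nat (g x) (\<lambda>_ _. f x) (if P x then 1 else 0))"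
    using assms unfolding decidable_in_def
    by (intro recursive_in_rec_nat recursive_in_compose[OF assms(2)] recI) auto
  also have "(\<lambda>x. rec_nat (g x) (\<lambda>_ _. f x) (if P x then 1 else 0 :: nat)) =
      (\<lambda>x. if P x then f x else g x)"
    by auto
  finally show ?thesis .
qed

lemma recursive_in_pred:
  assumes "recursive_in Z f" shows "recursive_in Z (\<lambda>x. f x - 1)"
proof -
  have "recursive_in Z (\<lambda>x. rec_nat 0 (\<lambda>k _. k) (f x))"
    by (intro recursive_in_rec_nat recI assms)
  also have "(\<lambda>x. rec_nat 0 (\<lambda>k _. k) (f x)) = (\<lambda>x. f x - 1)"
    by (auto split: nat.split simp: fun_eq_iff) (case_tac "f x"; simp)
  finally show ?thesis .
qed

lemma recursive_in_diff [recI]: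
  assumes "recursive_in Z f" "recursive_in Z g" shows "recursive_in Z (\<lambda>x. f x - g x)"
proof -
  have "rec_nat a (\<lambda>_ v. v - 1) k = a - k" for a k :: nat
    by (induction k) auto
  moreover have "recursive_in Z (\<lambda>x. rec_nat (f x) (\<lambda>_ v. v - 1) (g x))"
    by (intro recursive_in_rec_nat recursive_in_pred recI assms)
  ultimately show ?thesis by simp
qed

lemma decidable_in_eq_0:
  assumes "recursive_in Z f" shows "decidable_in Z (\<lambda>x. f x = 0)"
proof -
  have "rec_nat 1 (\<lambda>_ _. 0) k = (if k = 0 then 1 else 0 :: nat)" for k
    by (cases k) auto
  moreover have "recursive_in Z (\<lambda>x. rec_nat 1 (\<lambda>_ _. 0) (f x))"
    by (intro recursive_in_rec_nat recI assms)
  ultimately show ?thesis unfolding decidable_in_def by simp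
qed

lemma decidable_in_not [recI]:
  assumes "decidable_in Z P" shows "decidable_in Z (\<lambda>x. \<not> P x)"
proof -
  have "recursive_in Z (\<lambda>x. if P x then 0 else 1)"
    by (intro recI assms)
  also have "(\<lambda>x. if P x then 0 else 1 :: nat) = (\<lambda>x. if \<not> P x then 1 else 0)"
    by auto
  finally show ?thesis unfolding decidable_in_def .
qed

lemma decidable_in_conj [recI]:
  assumes "decidable_in Z P" "decidable_in Z Q" shows "decidable_in Z (\<lambda>x. P x \<and> Q x)"
proof -
  have "recursive_in Z (\<lambda>x. if P x then (if Q x then 1 else 0) else 0)"
    by (intro recI assms)
  also have "(\<lambda>x. if P x then (if Q x then 1 else 0) else 0 :: nat) =
      (\<lambda>x. if P x \<and> Q x then 1 else 0)"
    by auto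
  finally show ?thesis unfolding decidable_in_def .
qed

lemma decidable_in_disj [recI]:
  assumes "decidable_in Z P" "decidable_in Z Q" shows "decidable_in Z (\<lambda>x. P x \<or> Q x)"
proof -
  have "decidable_in Z (\<lambda>x. \<not> (\<not> P x \<and> \<not> Q x))"
    by (intro decidable_in_not decidable_in_conj assms)
  then show ?thesis by simp
qed

text \<open>Truncated subtraction gives 0 exactly when \<open>f x \<le> g x\<close>, so the
  comparisons reduce to a test for 0.\<close>

lemma decidable_in_le [recI]:
  assumes "recursive_in Z f" "recursive_in Z g" shows "decidable_in Z (\<lambda>x. f x \<le> g x)"
  using decidable_in_eq_0[OF recursive_in_diff[OF assms]] by simp

lemma decidable_in_less [recI]:
  assumes "recursive_in Z f" "recursive_in Z g" shows "decidable_in Z (\<lambda>x. f x < g x)"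
  using decidable_in_not[OF decidable_in_le[OF assms(2,1)]] by (simp add: not_le)

lemma decidable_in_eq [recI]:
  assumes "recursive_in Z f" "recursive_in Z g" shows "decidable_in Z (\<lambda>x. f x = g x)"
  using decidable_in_conj[OF decidable_in_le[OF assms] decidable_in_le[OF assms(2,1)]]
  by (simp add: eq_iff)

lemma decidable_in_compose:
  assumes "decidable_in Z P" "recursive_in Z f" shows "decidable_in Z (\<lambda>x. P (f x))"
  using recursive_in_compose[of Z "\<lambda>n. if P n then 1 else 0" f] assms
  unfolding decidable_in_def by simp

lemma decidable_in_compose2:
  assumes "decidable_in Z (\<lambda>z. P (pfst z) (psnd z))" "recursive_in Z f" "recursive_in Z g"
  shows "decidable_in Z (\<lambda>x. P (f x) (g x))"
  using decidable_in_compose[OF assms(1) recursive_in_pair[OF assms(2,3)]] by simp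

text \<open>The recursion carries the truth value of the disjunction over the indices seen so
  far.\<close>

lemma decidable_in_bex [recI]:
  assumes P: "decidable_in Z (\<lambda>z. P (pfst z) (psnd z))" and "recursive_in Z h"
  shows "decidable_in Z (\<lambda>x. \<exists>k<h x. P x k)"
proof -
  have "rec_nat 0 (\<lambda>k v. if P x k then 1 else v) m = (if \<exists>k<m. P x k then 1 else 0 :: nat)" for x m
    by (induction m) (auto simp: less_Suc_eq)
  moreover have "recursive_in Z (\<lambda>x. rec_nat 0 (\<lambda>k v. if P x k then 1 else v) (h x))"
    by (intro recursive_in_rec_nat decidable_in_compose2[where P = P, OF P] recI assms)
  ultimately show ?thesis unfolding decidable_in_def by simp
qed

lemma decidable_in_ball [recI]:
  assumes P: "decidable_in Z (\<lambda>z. P (pfst z) (psnd z))" and "recursive_in Z h"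
  shows "decidable_in Z (\<lambda>x. \<forall>k<h x. P x k)"
  using decidable_in_not[OF decidable_in_bex[OF decidable_in_not[OF P] assms(2)]] by simp

section \<open>Coded lists\<close>

text \<open>Since \<open>list_encode (x # xs)\<close> is
  \<open>Suc (prod_encode (x, list_encode xs))\<close>, the map \<open>psnd (v - 1)\<close> takes
  the tail and \<open>pfst (v - 1)\<close> the head. Iterating the former gives access to any
  position by primitive recursion.\<close>

definition drop_code :: "nat \<Rightarrow> nat \<Rightarrow> nat" where
  "drop_code l i = rec_nat l (\<lambda>_ v. psnd (v - 1)) i"

lemma recursive_in_drop_code [recI]:
  "recursive_in Z f \<Longrightarrow> recursive_in Z g \<Longrightarrow> recursive_in Z (\<lambda>x. drop_code (f x) (g x))"
  unfolding drop_code_def by (intro recursive_in_rec_nat recI)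

lemma drop_code_list_encode: "drop_code (list_encode xs) i = list_encode (drop i xs)"
proof (induction i)
  case (Suc i)
  have "psnd (list_encode ys - 1) = list_encode (tl ys)" for ys
    by (cases ys) auto
  with Suc show ?case by (simp add: drop_code_def drop_Suc tl_drop)
qed (simp add: drop_code_def)

lemma list_encode_eq_0_iff [simp]: "list_encode xs = 0 \<longleftrightarrow> xs = []"
  by (cases xs) auto

lemma drop_code_eq_0_iff: "drop_code l i = 0 \<longleftrightarrow> length (list_decode l) \<le> i"
  using drop_code_list_encode[of "list_decode l" i] by simp

lemma list_decode_drop_code: "list_decode (drop_code l i) = drop i (list_decode l)"
  using drop_code_list_encode[of "list_decode l" i] by simp

lemma pfst_drop_code: "i < length (list_decode l) \<Longrightarrow> pfst (drop_code l i - 1) = list_decode l ! i"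
  using drop_code_list_encode[of "list_decode l" i] by (simp flip: Cons_nth_drop_Suc)

text \<open>Bounds the number of rounds in the recursion for the length: it suffices to count the
  positions below \<open>l\<close> at which a nonempty rest remains.\<close>

lemma length_list_decode_le: "length (list_decode l) \<le> l"
proof -
  have "length xs \<le> list_encode xs" for xs
  proof (induction xs)
    case (Cons x xs)
    then show ?case using le_prod_encode_2[of "list_encode xs" x] by simp
  qed simp
  from this[of "list_decode l"] show ?thesis by simp
qed

lemma recursive_in_length_list_decode [recI]:
  assumes "recursive_in Z h" shows "recursive_in Z (\<lambda>x. length (list_decode (h x)))"
proof -
  have "rec_nat 0 (\<lambda>i v. if drop_code l i = 0 then v else Suc v) m =
      min m (length (list_decode l))" for l m
    by (induction m) (auto simp: drop_code_eq_0_iff)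
  then have "length (list_decode l) = rec_nat 0 (\<lambda>i v. if drop_code l i = 0 then v else Suc v) l" for l
    using length_list_decode_le[of l] by simp
  moreover have "recursive_in Z
      (\<lambda>x. rec_nat 0 (\<lambda>i v. if drop_code (h x) i = 0 then v else Suc v) (h x))"
    by (intro recursive_in_rec_nat decidable_in_eq recI assms recursive_in_compose[OF assms])
  ultimately show ?thesis by simp
qed

text \<open>A quantifier over entries becomes a bounded quantifier over positions.\<close>

lemma decidable_in_bex_set [recI]:
  assumes "decidable_in Z (\<lambda>z. P (pfst z) (psnd z))" "recursive_in Z h"
  shows "decidable_in Z (\<lambda>x. \<exists>r\<in>set (list_decode (h x)). P x r)"
proof -
  have eq: "(\<exists>r\<in>set (list_decode l). P x r) \<longleftrightarrow>
      (\<exists>i<length (list_decode l). P x (pfst (drop_code l i - 1)))" for x l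
    by (metis in_set_conv_nth pfst_drop_code)
  have "decidable_in Z (\<lambda>z. P (pfst z) (pfst (drop_code (h (pfst z)) (psnd z) - 1)))"
    by (rule decidable_in_compose2[where P = P, OF assms(1)])
      (intro recI recursive_in_compose[OF assms(2)])+
  then show ?thesis
    unfolding eq by (intro decidable_in_bex recursive_in_length_list_decode assms(2))
qed

lemma decidable_in_mem [recI]:
  assumes "recursive_in Z f" "recursive_in Z h"
  shows "decidable_in Z (\<lambda>x. f x \<in> set (list_decode (h x)))"
proof -
  have "decidable_in Z (\<lambda>x. \<exists>r\<in>set (list_decode (h x)). r = f x)"
    by (intro recI assms recursive_in_compose[OF assms(1)])
  then show ?thesis by simp
qed

section \<open>Derivations and the enumerability of the halting set\<close>

text \<open>The second component tells the two kinds of judgement apart: 0 for well-formed codes, a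
  successor for evaluations. Each is a single number, so a derivation is a list of numbers.\<close>

definition wf_judgement :: "nat \<Rightarrow> nat" where
  "wf_judgement e = prod_encode (e, 0)"

definition run_judgement :: "nat \<Rightarrow> nat \<Rightarrow> nat \<Rightarrow> nat" where
  "run_judgement e n v = prod_encode (e, Suc (prod_encode (n, v)))"

text \<open>On numbers that are not run judgements the result is arbitrary; the equations
  \<open>r = run_judgement ... (val r)\<close> below exclude these.\<close>

definition val :: "nat \<Rightarrow> nat" where
  "val r = psnd (psnd r - 1)"

lemma val_run_judgement [simp]: "val (run_judgement e n v) = v"
  by (simp add: val_def run_judgement_def)

text \<open>The tag \<open>pfst e\<close> follows \<open>prog_code\<close>: below 5 the atomic
  programs, 5 to 7 the binary constructors, 8 minimisation.\<close>

definition wf_rule :: "nat \<Rightarrow> nat set \<Rightarrow> bool" where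
  "wf_rule e X \<longleftrightarrow>
     pfst e < 5 \<and> psnd e = 0 \<or>
     5 \<le> pfst e \<and> pfst e < 8 \<and> wf_judgement (pfst (psnd e)) \<in> X \<and> wf_judgement (psnd (psnd e)) \<in> X \<or>
     pfst e = 8 \<and> wf_judgement (psnd e) \<in> X"

text \<open>The output of a premise is recovered from the premise itself, so that every quantifier
  ranges over the finite set of premises or below a number.\<close>

definition run_rule :: "nat \<Rightarrow> nat \<Rightarrow> nat \<Rightarrow> nat set \<Rightarrow> bool" where
  "run_rule e n v X \<longleftrightarrow>
     pfst e = 0 \<and> v = 0 \<or>
     pfst e = 1 \<and> v = Suc n \<or>
     pfst e = 2 \<and> v = pfst n \<or>
     pfst e = 3 \<and> v = psnd n \<or>
     pfst e = 4 \<and> v = 0 \<or>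
     pfst e = 5 \<and> run_judgement (pfst (psnd e)) n (pfst v) \<in> X \<and>
       run_judgement (psnd (psnd e)) n (psnd v) \<in> X \<or>
     pfst e = 6 \<and> (\<exists>r\<in>X. r = run_judgement (psnd (psnd e)) n (val r) \<and>
       run_judgement (pfst (psnd e)) (val r) v \<in> X) \<or>
     pfst e = 7 \<and> psnd n = 0 \<and> run_judgement (pfst (psnd e)) (pfst n) v \<in> X \<or>
     pfst e = 7 \<and> 0 < psnd n \<and>
       (\<exists>r\<in>X. r = run_judgement e (prod_encode (pfst n, psnd n - 1)) (val r) \<and>
         run_judgement (psnd (psnd e))
           (prod_encode (pfst n, prod_encode (psnd n - 1, val r))) v \<in> X) \<or>
     pfst e = 8 \<and> run_judgement (psnd e) (prod_encode (n, v)) 0 \<in> X \<and>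
       (\<forall>j<v. \<exists>r\<in>X. r = run_judgement (psnd e) (prod_encode (n, j)) (val r) \<and> 0 < val r)"

definition justified :: "nat \<Rightarrow> nat set \<Rightarrow> bool" where
  "justified x X \<longleftrightarrow>
     psnd x = 0 \<and> wf_rule (pfst x) X \<or>
     0 < psnd x \<and> run_rule (pfst x) (pfst (psnd x - 1)) (psnd (psnd x - 1)) X"

lemma justified_wf_judgement [simp]: "justified (wf_judgement e) X \<longleftrightarrow> wf_rule e X"
  by (simp add: justified_def wf_judgement_def)

lemma justified_run_judgement [simp]: "justified (run_judgement e n v) X \<longleftrightarrow> run_rule e n v X"
  by (simp add: justified_def run_judgement_def)

text \<open>Premises occur only positively in the rules.\<close>

lemma justified_mono:
  assumes "justified x X" "X \<subseteq> Y" shows "justified x Y"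
proof -
  have "wf_rule e Y" if "wf_rule e X" for e
    using that \<open>X \<subseteq> Y\<close> unfolding wf_rule_def by blast
  moreover have "run_rule e n v Y" if "run_rule e n v X" for e n v
    using that \<open>X \<subseteq> Y\<close> unfolding run_rule_def by (elim disj_forward conj_forward) blast+
  ultimately show ?thesis using assms(1) unfolding justified_def by blast
qed

text \<open>Placing premises behind conclusions rules out circular justifications and allows
  induction on the list; the premises open to entry \<open>i\<close> are coded by
  \<open>drop_code l (Suc i)\<close>.\<close>

definition derivation :: "nat list \<Rightarrow> bool" where
  "derivation xs \<longleftrightarrow> (\<forall>i<length xs. justified (xs ! i) (set (drop (Suc i) xs)))"

lemma derivation_Nil [simp]: "derivation []"
  by (simp add: derivation_def)

lemma derivation_Cons [simp]: "derivation (x # xs) \<longleftrightarrow> justified x (set xs) \<and> derivation xs"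
  by (auto simp: derivation_def nth_Cons' less_Suc_eq_0_disj)

lemma derivation_append: "derivation xs \<Longrightarrow> derivation ys \<Longrightarrow> derivation (xs @ ys)"
  by (induction xs) (auto elim: justified_mono)

lemma decidable_in_derivation [recI]:
  assumes "recursive_in Z h" shows "decidable_in Z (\<lambda>x. derivation (list_decode (h x)))"
proof -
  have eq: "derivation (list_decode l) \<longleftrightarrow>
    (\<forall>i<length (list_decode l).
       justified (pfst (drop_code l i - 1)) (set (list_decode (drop_code l (Suc i)))))" for l
    by (simp add: derivation_def pfst_drop_code list_decode_drop_code del: One_nat_def)
  \<comment> \<open>After unfolding, all quantifiers range over positions, entries of a coded list
    or numbers below a bound.\<close>
  have "decidable_in Z (\<lambda>l. derivation (list_decode l))"
    unfolding eq justified_def wf_rule_def run_rule_def wf_judgement_def run_judgement_def val_def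
    by (intro recI)
  from decidable_in_compose[OF this assms] show ?thesis .
qed

section \<open>Soundness of derivations\<close>

lemma derivation_wf_sound:
  "derivation xs \<Longrightarrow> wf_judgement e \<in> set xs \<Longrightarrow> \<exists>p. prog_code p = e"
proof (induction xs arbitrary: e)
  case (Cons x xs)
  \<comment> \<open>The premises of the head lie in the tail, so this yields programs for the
    immediate subcodes.\<close>
  have IH: "\<exists>p. prog_code p = e" if "wf_judgement e \<in> set xs" for e
    using Cons that by simp
  show ?case
  proof (cases "wf_judgement e \<in> set xs")
    case True
    then show ?thesis by (rule IH)
  next
    case False
    with Cons have "wf_rule e (set xs)" by auto
    moreover have "\<exists>p. prog_code p = e" if c: "pfst e < 5" and d: "psnd e = 0"
    proof -
      have "e = prod_encode (pfst e, 0)" using pair_pfst_psnd[of e] unfolding d by (rule sym)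
      with c obtain c where "e = prod_encode (c, 0)" "c < 5" by blast
      then have "e \<in> prog_code ` {Zero, Succ, First, Second, Oracle}"
        by auto
      then show ?thesis by blast
    qed
    moreover have "\<exists>p. prog_code p = e"
      if c: "5 \<le> pfst e" "pfst e < 8"
        and a: "wf_judgement (pfst (psnd e)) \<in> set xs" and b: "wf_judgement (psnd (psnd e)) \<in> set xs"
    proof -
      obtain p where p: "prog_code p = pfst (psnd e)" using IH[OF a] by blast
      obtain q where q: "prog_code q = psnd (psnd e)" using IH[OF b] by blast
      obtain c where "e = prod_encode (c, prod_encode (prog_code p, prog_code q))" "5 \<le> c" "c < 8"
        using c p q by (metis pair_pfst_psnd)
      then have "e \<in> prog_code ` {Tuple p q, Comp p q, PrimRec p q}"
        by auto
      then show ?thesis by blast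
    qed
    moreover have "\<exists>p. prog_code p = e" if "pfst e = 8" and a: "wf_judgement (psnd e) \<in> set xs"
    proof -
      obtain p where "prog_code p = psnd e" using IH[OF a] by blast
      then have "prog_code (Minim p) = e" using that by (metis pair_pfst_psnd prog_code.simps(9))
      then show ?thesis ..
    qed
    ultimately show ?thesis unfolding wf_rule_def by blast
  qed
qed simp

text \<open>With the next lemma, the recursion equations in a form that hides
  \<open>rec_nat\<close>.\<close>

lemma run_PrimRec_0: "run Z (PrimRec p q) (prod_encode (a, 0)) = run Z p a"
  by simp

lemma run_PrimRec_Suc:
  "run Z (PrimRec p q) (prod_encode (a, Suc k)) =
     Option.bind (run Z (PrimRec p q) (prod_encode (a, k)))
       (\<lambda>v. run Z q (prod_encode (a, prod_encode (k, v))))"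
  by simp

text \<open>Trades the least number operator for the shape of the minimisation rule: value 0 at
  \<open>v\<close>, positive values before.\<close>

lemma run_Minim_eq_Some_iff:
  "run Z (Minim p) n = Some v \<longleftrightarrow>
     run Z p (prod_encode (n, v)) = Some 0 \<and> (\<forall>j<v. \<exists>u>0. run Z p (prod_encode (n, j)) = Some u)"
  (is "_ \<longleftrightarrow> ?R")
proof -
  define good where "good k \<longleftrightarrow> run Z p (prod_encode (n, k)) = Some 0 \<and>
    (\<forall>j<k. run Z p (prod_encode (n, j)) \<noteq> None)" for k
  have run: "run Z (Minim p) n = (if \<exists>k. good k then Some (LEAST k. good k) else None)"
    by (simp only: run.simps Let_def good_def)
  have R: "?R \<longleftrightarrow> good v \<and> (\<forall>j<v. \<not> good j)"
  proof
    assume ?R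
    then show "good v \<and> (\<forall>j<v. \<not> good j)" by (auto simp only: good_def)
  next
    assume good: "good v \<and> (\<forall>j<v. \<not> good j)"
    have "\<exists>u>0. run Z p (prod_encode (n, j)) = Some u" if "j < v" for j
    proof -
      \<comment> \<open>All values up to \<open>j\<close> are defined because \<open>good v\<close>
        holds and \<open>j < v\<close>. Hence \<open>good j\<close> can fail only because the value
        at \<open>j\<close> is not 0.\<close>
      have "run Z p (prod_encode (n, i)) \<noteq> None" if "i \<le> j" for i
        using good \<open>j < v\<close> that by (simp add: good_def)
      then have "run Z p (prod_encode (n, j)) \<noteq> None" "run Z p (prod_encode (n, j)) \<noteq> Some 0"
        using good \<open>j < v\<close> unfolding good_def by (meson less_imp_le order_refl)+
      then show ?thesis by (cases "run Z p (prod_encode (n, j))") simp_all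
    qed
    with good show ?R unfolding good_def by blast
  qed
  have "(\<exists>k. good k) \<and> (LEAST k. good k) = v \<longleftrightarrow> good v \<and> (\<forall>j<v. \<not> good j)"
    using Least_equality[of good v] by (auto intro: LeastI dest: not_less_Least) (meson not_le)
  then show ?thesis unfolding run R by (cases "\<exists>k. good k") auto
qed

text \<open>Restricting to codes of programs is stable under the rules: the premises again concern
  codes of subprograms or of \<open>p\<close> itself. The oracle rule answers 0, as the empty oracle
  does.\<close>

lemma derivation_run_sound:
  "derivation xs \<Longrightarrow> run_judgement (prog_code p) n v \<in> set xs \<Longrightarrow> run {} p n = Some v"
proof (induction xs arbitrary: p n v)
  case (Cons x xs)
  have IH: "run {} p n = Some v" if "run_judgement (prog_code p) n v \<in> set xs" for p n v
    using Cons that by simp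
  show ?case
  proof (cases "run_judgement (prog_code p) n v \<in> set xs")
    case False
    with Cons.prems have rule: "run_rule (prog_code p) n v (set xs)" by auto
    show ?thesis
    proof (cases p)
      case (Tuple p1 p2)
      then show ?thesis using rule by (auto simp: run_rule_def dest!: IH)
    next
      case (Comp p1 p2)
      with rule obtain u where "run_judgement (prog_code p2) n u \<in> set xs"
        "run_judgement (prog_code p1) u v \<in> set xs"
        by (simp add: run_rule_def) metis
      then show ?thesis using Comp by (auto dest!: IH)
    next
      case (PrimRec p1 p2)
      show ?thesis
      proof (cases "psnd n")
        case 0
        then have "n = prod_encode (pfst n, 0)" by (metis pair_pfst_psnd)
        moreover have "run {} p1 (pfst n) = Some v"
          using rule PrimRec 0 by (auto simp: run_rule_def dest!: IH)
        ultimately show ?thesis using PrimRec run_PrimRec_0 by metis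
      next
        \<comment> \<open>One premise is about \<open>p\<close> itself with one round fewer;
          induction on the derivation covers it, induction on the program would not.\<close>
        case (Suc k)
        with rule PrimRec obtain u where
          "run_judgement (prog_code p) (prod_encode (pfst n, k)) u \<in> set xs"
          "run_judgement (prog_code p2) (prod_encode (pfst n, prod_encode (k, u))) v \<in> set xs"
          by (simp add: run_rule_def) metis
        then have "run {} p (prod_encode (pfst n, Suc k)) = Some v"
          unfolding PrimRec run_PrimRec_Suc by (auto simp only: bind.simps dest!: IH)
        then show ?thesis using Suc by (metis pair_pfst_psnd)
      qed
    next
      case (Minim q)
      with rule have "run_judgement (prog_code q) (prod_encode (n, v)) 0 \<in> set xs"
        "\<forall>j<v. \<exists>u>0. run_judgement (prog_code q) (prod_encode (n, j)) u \<in> set xs"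
        by (simp_all add: run_rule_def) metis
      then have "run {} q (prod_encode (n, v)) = Some 0"
        "\<forall>j<v. \<exists>u>0. run {} q (prod_encode (n, j)) = Some u"
        using IH by blast+
      then show ?thesis unfolding Minim run_Minim_eq_Some_iff by blast
    qed (use rule in \<open>simp_all add: run_rule_def pfst_def psnd_def\<close>)
  qed (rule IH)
qed simp

section \<open>Completeness of derivations\<close>

definition derivable :: "nat set" where
  "derivable = {x. \<exists>xs. derivation xs \<and> x \<in> set xs}"

text \<open>Concatenating derivations of the single elements gives one derivation of all of
  them.\<close>

lemma derivable_finite_subset:
  assumes "finite X" "X \<subseteq> derivable"
  shows "\<exists>xs. derivation xs \<and> X \<subseteq> set xs"
  using assms
proof (induction X)
  case empty
  then show ?case by (auto intro: exI[where x = "[]"])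
next
  case (insert x X)
  then obtain xs ys where "derivation xs" "x \<in> set xs" "derivation ys" "X \<subseteq> set ys"
    by (auto simp: derivable_def)
  then show ?case by (intro exI[where x = "xs @ ys"]) (auto intro: derivation_append)
qed

lemma derivable_rule:
  assumes "justified x X" "finite X" "X \<subseteq> derivable" shows "x \<in> derivable"
proof -
  obtain xs where "derivation xs" "X \<subseteq> set xs"
    using derivable_finite_subset assms by blast
  then have "derivation (x # xs)" using assms(1) justified_mono by simp
  then show ?thesis unfolding derivable_def by (intro CollectI exI[where x = "x # xs"]) simp
qed

lemma wf_derivable: "wf_judgement (prog_code p) \<in> derivable"
proof (induction p)
  case (Tuple p q)
  show ?case by (rule derivable_rule[where
    X = "{wf_judgement (prog_code p), wf_judgement (prog_code q)}"])
    (use Tuple in \<open>auto simp: wf_rule_def\<close>)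
next
  case (Comp p q)
  show ?case by (rule derivable_rule[where
    X = "{wf_judgement (prog_code p), wf_judgement (prog_code q)}"])
    (use Comp in \<open>auto simp: wf_rule_def\<close>)
next
  case (PrimRec p q)
  show ?case by (rule derivable_rule[where
    X = "{wf_judgement (prog_code p), wf_judgement (prog_code q)}"])
    (use PrimRec in \<open>auto simp: wf_rule_def\<close>)
next
  case (Minim p)
  show ?case by (rule derivable_rule[where X = "{wf_judgement (prog_code p)}"])
    (use Minim in \<open>auto simp: wf_rule_def\<close>)
qed (rule derivable_rule[where X = "{}"], simp_all add: wf_rule_def)+

text \<open>Each defined computation needs only finitely many subcomputations; \<open>X\<close>
  collects their judgements.\<close>

lemma run_derivable: "run {} p n = Some v \<Longrightarrow> run_judgement (prog_code p) n v \<in> derivable"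
proof (induction p arbitrary: n v)
  case (Tuple p q)
  then obtain x y where "run {} p n = Some x" "run {} q n = Some y" "v = prod_encode (x, y)"
    by (auto simp: bind_eq_Some_conv)
  with Tuple.IH show ?case by (intro derivable_rule[where
    X = "{run_judgement (prog_code p) n x, run_judgement (prog_code q) n y}"])
    (auto simp: run_rule_def)
next
  case (Comp p q)
  then obtain y where "run {} q n = Some y" "run {} p y = Some v"
    by (auto simp: bind_eq_Some_conv)
  with Comp.IH show ?case by (intro derivable_rule[where
    X = "{run_judgement (prog_code q) n y, run_judgement (prog_code p) y v}"])
    (auto simp: run_rule_def)
next
  case (PrimRec p q)
  \<comment> \<open>A round uses the previous value of the same program, which the hypotheses on
    \<open>p\<close> and \<open>q\<close> do not cover; hence an inner induction on the number of
    rounds.\<close>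
  have "run_judgement (prog_code (PrimRec p q)) (prod_encode (a, k)) v \<in> derivable"
    if "run {} (PrimRec p q) (prod_encode (a, k)) = Some v" for a k v
    using that
  proof (induction k arbitrary: v)
    case 0
    then have "run_judgement (prog_code p) a v \<in> derivable"
      unfolding run_PrimRec_0 by (rule PrimRec.IH(1))
    then show ?case by (intro derivable_rule[where X = "{run_judgement (prog_code p) a v}"])
      (auto simp: run_rule_def)
  next
    case (Suc k)
    then obtain u where u: "run {} (PrimRec p q) (prod_encode (a, k)) = Some u"
      and v: "run {} q (prod_encode (a, prod_encode (k, u))) = Some v"
      unfolding run_PrimRec_Suc by (auto simp only: bind_eq_Some_conv)
    show ?case
      by (rule derivable_rule[where
        X = "{run_judgement (prog_code (PrimRec p q)) (prod_encode (a, k)) u,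
              run_judgement (prog_code q) (prod_encode (a, prod_encode (k, u))) v}"])
        (use Suc.IH[OF u] PrimRec.IH(2)[OF v] in \<open>auto simp: run_rule_def\<close>)
  qed
  from this[of "pfst n" "psnd n"] PrimRec.prems show ?case
    by (simp only: pair_pfst_psnd)
next
  case (Minim p)
  then have 0: "run {} p (prod_encode (n, v)) = Some 0"
    and "\<forall>j. \<exists>u. j < v \<longrightarrow> u > 0 \<and> run {} p (prod_encode (n, j)) = Some u"
    unfolding run_Minim_eq_Some_iff by auto
  \<comment> \<open>Choosing one output \<open>u j\<close> for each \<open>j < v\<close> keeps the
    set of premises finite.\<close>
  then obtain u where u: "\<And>j. j < v \<Longrightarrow> u j > 0 \<and> run {} p (prod_encode (n, j)) = Some (u j)"
    by metis
  show ?case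
    by (rule derivable_rule[where X = "insert (run_judgement (prog_code p) (prod_encode (n, v)) 0)
        ((\<lambda>j. run_judgement (prog_code p) (prod_encode (n, j)) (u j)) ` {..<v})"])
      (use 0 u Minim.IH in \<open>auto simp: run_rule_def\<close>)
qed (rule derivable_rule[where X = "{}"], simp_all add: run_rule_def pfst_def psnd_def)+

text \<open>A run judgement alone does not ensure that \<open>pfst x\<close> codes a program: the
  rules for atomic tags ignore \<open>psnd e\<close>, and recursion with zero rounds never inspects
  the code of the step. Hence the additional \<open>wf_judgement\<close>.\<close>

definition halting_witness :: "nat \<Rightarrow> nat \<Rightarrow> bool" where
  "halting_witness x l \<longleftrightarrow> derivation (list_decode l) \<and>
     wf_judgement (pfst x) \<in> set (list_decode l) \<and>
     (\<exists>r\<in>set (list_decode l). r = run_judgement (pfst x) (psnd x) (val r))"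

lemma decidable_halting_witness: "decidable_in Z (\<lambda>z. halting_witness (pfst z) (psnd z))"
  unfolding halting_witness_def wf_judgement_def run_judgement_def val_def by (intro recI)

lemma halting_set_iff: "x \<in> halting_set \<longleftrightarrow> (\<exists>l. halting_witness x l)"
proof
  assume "x \<in> halting_set"
  then obtain p n v where x: "x = prod_encode (prog_code p, n)" and v: "run {} p n = Some v"
    unfolding halting_set_def by auto
  obtain xs where "derivation xs"
    "{wf_judgement (prog_code p), run_judgement (prog_code p) n v} \<subseteq> set xs"
    using derivable_finite_subset[of "{wf_judgement (prog_code p), run_judgement (prog_code p) n v}"]
      wf_derivable run_derivable[OF v] by auto
  then have "halting_witness x (list_encode xs)"
    by (auto simp: halting_witness_def x intro!: bexI[where x = "run_judgement (prog_code p) n v"])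
  then show "\<exists>l. halting_witness x l" ..
next
  assume "\<exists>l. halting_witness x l"
  then obtain l v where l: "derivation (list_decode l)" "wf_judgement (pfst x) \<in> set (list_decode l)"
    "run_judgement (pfst x) (psnd x) v \<in> set (list_decode l)"
    unfolding halting_witness_def by metis
  then obtain p where p: "prog_code p = pfst x" using derivation_wf_sound by blast
  with l have "run {} p (psnd x) = Some v" using derivation_run_sound by metis
  with p show "x \<in> halting_set"
    unfolding halting_set_def by (intro CollectI exI[where x = "pfst x"] exI[where x = "psnd x"]) auto
qed

section \<open>The tree of least witnesses\<close>

definition witness_entry :: "(nat \<Rightarrow> nat \<Rightarrow> bool) \<Rightarrow> nat \<Rightarrow> nat \<Rightarrow> bool" where
  "witness_entry W i s \<longleftrightarrow> 0 < s \<and> W i (s - 1) \<and> (\<forall>t<s - 1. \<not> W i t)"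

definition witness_tree :: "(nat \<Rightarrow> nat \<Rightarrow> bool) \<Rightarrow> nat list set" where
  "witness_tree W = {\<sigma>. \<forall>i<length \<sigma>.
     \<sigma> ! i = 0 \<and> (\<forall>t<length \<sigma>. \<not> W i t) \<or> witness_entry W i (\<sigma> ! i)}"

lemma witness_entry_unique: "witness_entry W i s \<Longrightarrow> witness_entry W i t \<Longrightarrow> s = t"
  unfolding witness_entry_def by (cases s; cases t) (auto, meson linorder_neqE_nat)

lemma witness_entry_exists: "W i t \<Longrightarrow> \<exists>s. witness_entry W i s"
  by (rule exI[where x = "Suc (LEAST t. W i t)"])
    (auto simp: witness_entry_def intro: LeastI dest: not_less_Least)

text \<open>In a shorter sequence the guess 0 faces fewer tests, and the condition on a positive
  guess does not depend on the length.\<close>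

lemma is_tree_witness_tree: "is_tree (witness_tree W)"
  unfolding is_tree_def
proof (intro allI impI)
  fix \<sigma> \<tau> assume "strict_prefix \<sigma> \<tau>" "\<tau> \<in> witness_tree W"
  then obtain \<rho> where "\<tau> = \<sigma> @ \<rho>" unfolding strict_prefix_def prefix_def by blast
  have "\<sigma> ! i = 0 \<and> (\<forall>t<length \<sigma>. \<not> W i t) \<or> witness_entry W i (\<sigma> ! i)"
    if "i < length \<sigma>" for i
  proof -
    have "i < length (\<sigma> @ \<rho>)" "(\<sigma> @ \<rho>) ! i = \<sigma> ! i" using that by (simp_all add: nth_append)
    then have "\<sigma> ! i = 0 \<and> (\<forall>t<length (\<sigma> @ \<rho>). \<not> W i t) \<or> witness_entry W i (\<sigma> ! i)"
      using \<open>\<tau> \<in> witness_tree W\<close> unfolding witness_tree_def \<open>\<tau> = \<sigma> @ \<rho>\<close> by force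
    then show ?thesis by auto
  qed
  then show "\<sigma> \<in> witness_tree W"
    by (simp add: witness_tree_def)
qed

text \<open>Every quantifier is bounded: positions and tests of a guess 0 by the length, the
  minimality test by the entry itself.\<close>

lemma computable_tree_witness_tree:
  assumes "decidable_in {} (\<lambda>z. W (pfst z) (psnd z))"
  shows "computable_tree (witness_tree W)"
proof -
  have "l \<in> list_encode ` witness_tree W \<longleftrightarrow> list_decode l \<in> witness_tree W" for l
    by (metis image_iff list_decode_inverse list_encode_inverse)
  moreover have "list_decode l \<in> witness_tree W \<longleftrightarrow> (\<forall>i<length (list_decode l).
      pfst (drop_code l i - 1) = 0 \<and> (\<forall>t<length (list_decode l). \<not> W i t) \<or>
      witness_entry W i (pfst (drop_code l i - 1)))" for l
    by (auto simp: witness_tree_def pfst_drop_code simp del: One_nat_def)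
  moreover have "decidable_in {} (\<lambda>l. \<forall>i<length (list_decode l).
      pfst (drop_code l i - 1) = 0 \<and> (\<forall>t<length (list_decode l). \<not> W i t) \<or>
      witness_entry W i (pfst (drop_code l i - 1)))"
    unfolding witness_entry_def
    by (intro decidable_in_compose2[where P = W, OF assms] recI)
  ultimately have "computable (list_encode ` witness_tree W)"
    unfolding computable_def turing_le_iff_decidable_in by simp
  then show ?thesis using is_tree_witness_tree by (simp add: computable_tree_def)
qed

lemma finitely_branching_witness_tree: "finitely_branching (witness_tree W)"
  unfolding finitely_branching_def
proof
  fix \<sigma>
  have entry: "i = 0 \<or> witness_entry W (length \<sigma>) i" if "\<sigma> @ [i] \<in> witness_tree W" for i
    using that unfolding witness_tree_def by (auto dest!: spec[where x = "length \<sigma>"])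
  \<comment> \<open>\<open>s\<close> is the only possible positive last entry, and arbitrary if
    there is none; so no child has a label above \<open>s\<close>.\<close>
  obtain s where s: "\<And>i. witness_entry W (length \<sigma>) i \<Longrightarrow> i = s"
    using witness_entry_unique by metis
  have "\<forall>i\<ge>Suc s. \<sigma> @ [i] \<notin> witness_tree W"
    using entry s by fastforce
  then show "\<exists>N. \<forall>i\<ge>N. \<sigma> @ [i] \<notin> witness_tree W" ..
qed

text \<open>Along a branch a guess 0 is tested at every length, so the bound on \<open>t\<close>
  disappears.\<close>

lemma is_branch_witness_tree_iff:
  "is_branch (witness_tree W) f \<longleftrightarrow>
     (\<forall>i. f i = 0 \<and> (\<forall>t. \<not> W i t) \<or> witness_entry W i (f i))" (is "?B \<longleftrightarrow> ?F")
proof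
  assume ?B
  then have B: "f i = 0 \<and> (\<forall>t<n. \<not> W i t) \<or> witness_entry W i (f i)" if "i < n" for i n
    using that unfolding is_branch_def witness_tree_def by (auto dest!: spec[where x = n])
  show ?F
  proof
    fix i
    show "f i = 0 \<and> (\<forall>t. \<not> W i t) \<or> witness_entry W i (f i)"
    proof (cases "witness_entry W i (f i)")
      case False
      \<comment> \<open>The length \<open>Suc (i + t)\<close> exceeds both the position
        \<open>i\<close> and the candidate witness \<open>t\<close>.\<close>
      then have "f i = 0 \<and> \<not> W i t" for t
        using B[of i "Suc (i + t)"] by auto
      then show ?thesis by blast
    qed simp
  qed
next
  assume ?F
  then show ?B unfolding is_branch_def witness_tree_def by fastforce
qed

text \<open>The condition on a branch treats each \<open>i\<close> separately, so a unique
  admissible value at every \<open>i\<close> determines a unique function.\<close>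

lemma ex1_branch_witness_tree: "\<exists>!f. is_branch (witness_tree W) f"
proof -
  have "\<exists>!s. s = 0 \<and> (\<forall>t. \<not> W i t) \<or> witness_entry W i s" for i
  proof (cases "\<exists>t. W i t")
    case True
    then show ?thesis using witness_entry_exists witness_entry_unique by metis
  next
    case False
    then show ?thesis by (auto simp: witness_entry_def)
  qed
  then show ?thesis unfolding is_branch_witness_tree_iff
    by (rule_tac ex_ex1I) (metis, rule ext, metis)
qed

lemma branch_witness_tree_nonzero_iff:
  "is_branch (witness_tree W) f \<Longrightarrow> f i \<noteq> 0 \<longleftrightarrow> (\<exists>t. W i t)"
  unfolding is_branch_witness_tree_iff witness_entry_def by (metis less_numeral_extra(3))

theorem theorem5p2p4:
  shows "\<exists>T. computable_tree T \<and> finitely_branching T \<and> (\<exists>!f. is_branch T f) \<and>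
    (\<forall>f. is_branch T f \<longrightarrow> halting_set \<le>\<^sub>T fun_graph f)"
proof (intro exI conjI allI impI)
  let ?T = "witness_tree halting_witness"
  show "computable_tree ?T"
    by (rule computable_tree_witness_tree) (rule decidable_halting_witness)
  show "finitely_branching ?T" by (rule finitely_branching_witness_tree)
  show "\<exists>!f. is_branch ?T f" by (rule ex1_branch_witness_tree)
  fix f assume f: "is_branch ?T f"
  have query: "decidable_in (fun_graph f) (\<lambda>x. x \<in> fun_graph f)"
    unfolding decidable_in_def by (rule recursive_inI[where p = Oracle]) simp
  \<comment> \<open>A single query decides membership of \<open>x\<close>: the branch has value 0 at
    \<open>x\<close> exactly when \<open>x\<close> has no halting witness.\<close>
  have "decidable_in (fun_graph f) (\<lambda>x. \<not> prod_encode (x, 0) \<in> fun_graph f)"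
    by (intro decidable_in_not decidable_in_compose[OF query] recI)
  moreover have "prod_encode (x, 0) \<notin> fun_graph f \<longleftrightarrow> x \<in> halting_set" for x
    using branch_witness_tree_nonzero_iff[OF f, of x]
    by (auto simp: fun_graph_def halting_set_iff)
  ultimately show "halting_set \<le>\<^sub>T fun_graph f"
    by (simp add: turing_le_iff_decidable_in)
qed

end
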